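(* Let $a,b\in\mathbb{R}$ with $0<a<b$. Then for all $\alpha,\lambda\in[0,1]$ and $q\ge 1$, $$\left|\lambda H_\alpha^{-1}(a,b)+(1-\lambda)A_\alpha^{-1}(a,b)-L^{-1}(a,b)\right|$$ $$\le\begin{cases}(b-a)(\gamma_2+\upsilon_2)K^{1/q}, & \alpha\lambda\le 1-\alpha\le 1-\lambda(1-\alpha),\\ (b-a)(\gamma_2+\upsilon_1)K^{1/q}, & \alpha\lambda\le 1-\lambda(1-\alpha)\le 1-\alpha,\\ (b-a)(\gamma_1+\upsilon_2)K^{1/q}, & 1-\alpha\le\alpha\lambda\le 1-\lambda(1-\alpha),\end{cases}$$ where $K=\sup\{a^{-2q},b^{-2q}\}$ and $$\gamma_1=(1-\alpha)\left[\alpha\lambda-\frac{1-\alpha}{2}\right],\qquad \gamma_2=(\alpha\lambda)^2-\gamma_1,$$ $$\upsilon_1=\frac{1-(1-\alpha)^2}{2}-\alpha\left[1-\lambda(1-\alpha)\right],\qquad \upsilon_2=\frac{1+(1-\alpha)^2}{2}-(\lambda+1)(1-\alpha)\left[1-\lambda(1-\alpha)\right].$$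
   Context: Means, for $a,b>0$, $a\neq b$: weighted arithmetic mean $A_\alpha(a,b)=\alpha a+(1-\alpha)b$; weighted harmonic mean $H_\alpha(a,b)=\left(\frac{\alpha}{a}+\frac{1-\alpha}{b}\right)^{-1}$; logarithmic mean $L(a,b)=\frac{b-a}{\ln b-\ln a}$. The superscript $-1$ denotes the reciprocal, e.g. $L^{-1}(a,b)=1/L(a,b)$. *)

theory Defs
  imports Complex_Main
begin

definition arith_mean :: "real \<Rightarrow> real \<Rightarrow> real \<Rightarrow> real" where
  "arith_mean \<alpha> a b = \<alpha> * a + (1 - \<alpha>) * b"

definition harm_mean :: "real \<Rightarrow> real \<Rightarrow> real \<Rightarrow> real" where
  "harm_mean \<alpha> a b = inverse (\<alpha> / a + (1 - \<alpha>) / b)"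

(* Meant for distinct positive arguments only. *)
definition log_mean :: "real \<Rightarrow> real \<Rightarrow> real" where
  "log_mean a b = (b - a) / (ln b - ln a)"

(* The weight called lambda in the source is written \<mu>, as \<lambda> is reserved. *)
definition gamma1 :: "real \<Rightarrow> real \<Rightarrow> real" where
  "gamma1 \<alpha> \<mu> = (1 - \<alpha>) * (\<alpha> * \<mu> - (1 - \<alpha>) / 2)"

definition gamma2 :: "real \<Rightarrow> real \<Rightarrow> real" where
  "gamma2 \<alpha> \<mu> = (\<alpha> * \<mu>)\<^sup>2 - gamma1 \<alpha> \<mu>"

definition upsilon1 :: "real \<Rightarrow> real \<Rightarrow> real" where
  "upsilon1 \<alpha> \<mu> = (1 - (1 - \<alpha>)\<^sup>2) / 2 - \<alpha> * (1 - \<mu> * (1 - \<alpha>))"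

definition upsilon2 :: "real \<Rightarrow> real \<Rightarrow> real" where
  "upsilon2 \<alpha> \<mu> =
     (1 + (1 - \<alpha>)\<^sup>2) / 2 - (\<mu> + 1) * (1 - \<alpha>) * (1 - \<mu> * (1 - \<alpha>))"

definition K_sup :: "real \<Rightarrow> real \<Rightarrow> real \<Rightarrow> real" where
  "K_sup q a b = Sup {a powr (-2 * q), b powr (-2 * q)}"

end

theory Submission
  imports Defs
begin

text \<open>
  With $f(x) = 1/x$ and $g(t) = f(a + t(b-a))$, integration by parts expresses the quantity inside
  the absolute value as
  $\int_0^{1-\alpha} (t - \alpha\mu)\, g'(t)\, dt + \int_{1-\alpha}^1 (t - 1 + \mu(1-\alpha))\, g'(t)\, dt$.
  Since $|g'| \le (b-a)/a^2$ and $K^{1/q} = 1/a^2$, it remains to evaluate $\int |t - c|\, dt$ on the two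
  pieces; whether $c$ lies inside the piece or not yields the various $\gamma_i$, $\upsilon_i$.
\<close>

text \<open>A primitive of the absolute value that is differentiable even at the kink
  \<open>c\<close>, so the integral of the kernel need not be split where the kernel changes
  sign.\<close>

lemma DERIV_half_mult_abs:
  "((\<lambda>t. (t - c) * \<bar>t - c\<bar> / 2) has_real_derivative \<bar>x - c\<bar>) (at x)"
proof (cases x c rule: linorder_cases)
  case equal
  \<comment> \<open>At the kink the difference quotient with increment \<open>h\<close> equals
    \<open>\<bar>h\<bar> / 2\<close>.\<close>
  have "((\<lambda>h. \<bar>h\<bar> / 2) \<longlongrightarrow> (0::real)) (at 0)"
    by (auto intro!: tendsto_eq_intros)
  then have "((\<lambda>h. ((x + h - c) * \<bar>x + h - c\<bar> / 2 - (x - c) * \<bar>x - c\<bar> / 2) / h) \<longlongrightarrow> 0) (at 0)"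
    by (rule Lim_transform_eventually) (auto simp: equal eventually_at_filter)
  with equal show ?thesis by (simp add: DERIV_def)
next
  case less
  have "((\<lambda>t. - ((t - c)\<^sup>2 / 2)) has_real_derivative \<bar>x - c\<bar>) (at x)"
    using less by (auto intro!: derivative_eq_intros simp: field_simps)
  then show ?thesis
    by (rule has_field_derivative_transform_within_open[where S = "{..<c}"])
       (use less in \<open>auto simp: power2_eq_square field_simps\<close>)
next
  case greater
  have "((\<lambda>t. (t - c)\<^sup>2 / 2) has_real_derivative \<bar>x - c\<bar>) (at x)"
    using greater by (auto intro!: derivative_eq_intros)
  then show ?thesis
    by (rule has_field_derivative_transform_within_open[where S = "{c<..}"])
       (use greater in \<open>auto simp: power2_eq_square\<close>)
qed

text \<open>Both \<open>P - F\<close> and \<open>P + F\<close> have nonnegative derivative, hence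
  are nondecreasing. This stands in for bounding an integral by the integral of a majorant, with no
  integrability to check.\<close>

lemma abs_diff_le_of_derivative_dominated:
  fixes F P :: "real \<Rightarrow> real"
  assumes "u \<le> v"
    and F: "\<And>t. u \<le> t \<Longrightarrow> t \<le> v \<Longrightarrow> (F has_real_derivative F' t) (at t)"
    and P: "\<And>t. u \<le> t \<Longrightarrow> t \<le> v \<Longrightarrow> (P has_real_derivative P' t) (at t)"
    and le: "\<And>t. u \<le> t \<Longrightarrow> t \<le> v \<Longrightarrow> \<bar>F' t\<bar> \<le> P' t"
  shows "\<bar>F v - F u\<bar> \<le> P v - P u"
proof -
  have "P u - F u \<le> P v - F v"
    by (rule DERIV_nonneg_imp_nondecreasing[OF \<open>u \<le> v\<close>])
       (use DERIV_diff[OF P F] le in \<open>force simp: abs_le_iff\<close>)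
  moreover have "P u + F u \<le> P v + F v"
    by (rule DERIV_nonneg_imp_nondecreasing[OF \<open>u \<le> v\<close>])
       (use DERIV_add[OF P F] le in \<open>force simp: abs_le_iff\<close>)
  ultimately show ?thesis by linarith
qed

text \<open>The left-hand side is $\int_u^v (t - c)\, g'(t)\, dt$ after integration by parts, and the
  right-hand side is $M \int_u^v |t - c|\, dt$.\<close>

lemma parts_linear_kernel_bound:
  fixes G g :: "real \<Rightarrow> real"
  assumes "u \<le> v"
    and G: "\<And>t. u \<le> t \<Longrightarrow> t \<le> v \<Longrightarrow> (G has_real_derivative g t) (at t)"
    and g: "\<And>t. u \<le> t \<Longrightarrow> t \<le> v \<Longrightarrow> (g has_real_derivative g' t) (at t)"
    and le: "\<And>t. u \<le> t \<Longrightarrow> t \<le> v \<Longrightarrow> \<bar>g' t\<bar> \<le> M"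
  shows "\<bar>(v - c) * g v - (u - c) * g u - (G v - G u)\<bar>
           \<le> M * ((v - c) * \<bar>v - c\<bar> / 2 - (u - c) * \<bar>u - c\<bar> / 2)"
proof -
  \<comment> \<open>Grouped by endpoint, the left side is an increment of
    \<open>(t - c) * g t - G t\<close>; its derivative is \<open>(t - c) * g' t\<close>, since
    \<open>g t\<close> from the product rule cancels against the derivative of
    \<open>G\<close>.\<close>
  have "\<bar>((v - c) * g v - G v) - ((u - c) * g u - G u)\<bar>
          \<le> M * ((v - c) * \<bar>v - c\<bar> / 2) - M * ((u - c) * \<bar>u - c\<bar> / 2)"
  proof (rule abs_diff_le_of_derivative_dominated[OF \<open>u \<le> v\<close>])
    fix t assume t: "u \<le> t" "t \<le> v"
    show "((\<lambda>t. (t - c) * g t - G t) has_real_derivative (t - c) * g' t) (at t)"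
      by (rule derivative_eq_intros G[OF t] g[OF t] refl)+ simp
    show "((\<lambda>t. M * ((t - c) * \<bar>t - c\<bar> / 2)) has_real_derivative M * \<bar>t - c\<bar>) (at t)"
      by (rule DERIV_cmult[OF DERIV_half_mult_abs])
    show "\<bar>(t - c) * g' t\<bar> \<le> M * \<bar>t - c\<bar>"
      using le[OF t] by (simp add: abs_mult mult.commute mult_right_mono)
  qed
  then show ?thesis by (simp add: algebra_simps)
qed

text \<open>A negative power is decreasing, so the supremum is attained at \<open>a\<close>; the
  outer exponent then cancels \<open>q\<close>.\<close>

lemma K_sup_powr:
  assumes "0 < a" "a \<le> b" "0 < q"
  shows "K_sup q a b powr (1 / q) = 1 / a\<^sup>2"
proof -
  have "b powr (-2 * q) \<le> a powr (-2 * q)"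
    using assms by (intro powr_mono2') auto
  then have "K_sup q a b = a powr (-2 * q)"
    by (simp add: K_sup_def cSup_eq_Max max_def)
  also have "\<dots> powr (1 / q) = a powr (-2)"
    using assms by (simp add: powr_powr)
  also have "\<dots> = 1 / a\<^sup>2"
    using assms by (simp add: powr_minus_divide)
  finally show ?thesis .
qed

text \<open>The absolute values on the right stay unresolved, so that one estimate serves every
  position of the kernel zeros relative to the breakpoint \<open>1 - \<alpha>\<close>.\<close>

lemma weighted_means_deviation_bound:
  fixes a b \<alpha> \<mu> :: real
  assumes "0 < a" and "a < b" and "\<alpha> \<in> {0..1}"
  shows "\<bar>\<mu> * inverse (harm_mean \<alpha> a b) + (1 - \<mu>) * inverse (arith_mean \<alpha> a b)
            - inverse (log_mean a b)\<bar>
    \<le> (b - a) / a\<^sup>2 *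
        (((1 - \<alpha> - \<alpha> * \<mu>) * \<bar>1 - \<alpha> - \<alpha> * \<mu>\<bar> / 2 + \<alpha> * \<mu> * \<bar>\<alpha> * \<mu>\<bar> / 2)
         + (\<mu> * (1 - \<alpha>) * \<bar>\<mu> * (1 - \<alpha>)\<bar> / 2
            - (\<mu> * (1 - \<alpha>) - \<alpha>) * \<bar>\<mu> * (1 - \<alpha>) - \<alpha>\<bar> / 2))"
    (is "\<bar>?E\<bar> \<le> ?M * (?P + ?Q)")
proof -
  \<comment> \<open>The segment from \<open>a\<close> to \<open>b\<close>, which passes through the
    arithmetic mean at \<open>t = 1 - \<alpha>\<close>.\<close>
  define s where "s t = a + t * (b - a)" for t
  define g where "g t = 1 / s t" for t
  define g' where "g' t = - (b - a) / (s t)\<^sup>2" for t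
  define G where "G t = ln (s t) / (b - a)" for t
  have s: "a \<le> s t" if "0 \<le> t" for t
    using that assms by (simp add: s_def)
  have ds: "(s has_real_derivative (b - a)) (at t)" for t
    unfolding s_def by (auto intro!: derivative_eq_intros)
  have dg: "(g has_real_derivative g' t) (at t)" if "0 \<le> t" for t
    unfolding g_def g'_def using s[OF that] assms
    by (auto intro!: derivative_eq_intros ds simp: power2_eq_square)
  have dG: "(G has_real_derivative g t) (at t)" if "0 \<le> t" for t
    unfolding G_def g_def using s[OF that] assms
    by (auto intro!: derivative_eq_intros ds)
  have bound: "\<bar>g' t\<bar> \<le> ?M" if "0 \<le> t" for t
    using s[OF that] assms by (auto simp: g'_def abs_divide intro!: divide_left_mono power_mono)
  have \<alpha>: "0 \<le> \<alpha>" "\<alpha> \<le> 1" using assms by auto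
  have 1: "\<bar>(1 - \<alpha> - \<alpha> * \<mu>) * g (1 - \<alpha>) - (0 - \<alpha> * \<mu>) * g 0 - (G (1 - \<alpha>) - G 0)\<bar>
      \<le> ?M * ((1 - \<alpha> - \<alpha> * \<mu>) * \<bar>1 - \<alpha> - \<alpha> * \<mu>\<bar> / 2 - (0 - \<alpha> * \<mu>) * \<bar>0 - \<alpha> * \<mu>\<bar> / 2)"
    by (rule parts_linear_kernel_bound[where g' = g']) (use \<alpha> dg dG bound in auto)
  \<comment> \<open>This zero makes the boundary term at 1 equal to
    \<open>\<mu> * (1 - \<alpha>) * g 1\<close>, the part of the harmonic term belonging to
    \<open>b\<close>; the part belonging to \<open>a\<close> comes from the boundary term at 0
    above.\<close>
  define c where "c = 1 - \<mu> * (1 - \<alpha>)"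
  have 2: "\<bar>(1 - c) * g 1 - (1 - \<alpha> - c) * g (1 - \<alpha>) - (G 1 - G (1 - \<alpha>))\<bar>
      \<le> ?M * ((1 - c) * \<bar>1 - c\<bar> / 2 - (1 - \<alpha> - c) * \<bar>1 - \<alpha> - c\<bar> / 2)"
    by (rule parts_linear_kernel_bound[where g' = g']) (use \<alpha> dg dG bound in auto)
  have c: "1 - c = \<mu> * (1 - \<alpha>)" "1 - \<alpha> - c = \<mu> * (1 - \<alpha>) - \<alpha>"
    by (auto simp: c_def)
  have means: "inverse (harm_mean \<alpha> a b) = \<alpha> * g 0 + (1 - \<alpha>) * g 1"
    "inverse (arith_mean \<alpha> a b) = g (1 - \<alpha>)" "inverse (log_mean a b) = G 1 - G 0"
    by (simp_all add: harm_mean_def arith_mean_def log_mean_def g_def G_def s_def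
        algebra_simps inverse_eq_divide flip: diff_divide_distrib)
  \<comment> \<open>The two coefficients of \<open>g (1 - \<alpha>)\<close> add up to
    \<open>1 - \<mu>\<close>, and the increments of \<open>G\<close> telescope.\<close>
  have E: "?E =
      ((1 - \<alpha> - \<alpha> * \<mu>) * g (1 - \<alpha>) - (0 - \<alpha> * \<mu>) * g 0 - (G (1 - \<alpha>) - G 0))
      + (\<mu> * (1 - \<alpha>) * g 1 - (\<mu> * (1 - \<alpha>) - \<alpha>) * g (1 - \<alpha>) - (G 1 - G (1 - \<alpha>)))"
    unfolding means by (simp add: algebra_simps)
  have "\<bar>?E\<bar> \<le> ?M * ?P + ?M * ?Q"
    unfolding E by (rule order_trans[OF abs_triangle_ineq add_mono]) (use 1 2[unfolded c] in simp_all)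
  then show ?thesis
    by (simp only: distrib_left)
qed

theorem proposition3:
  fixes a b \<alpha> \<mu> q :: real
  assumes "0 < a" and "a < b"
    and "\<alpha> \<in> {0..1}" and "\<mu> \<in> {0..1}" and "q \<ge> 1"
  shows "let D = \<bar>\<mu> * inverse (harm_mean \<alpha> a b)
                   + (1 - \<mu>) * inverse (arith_mean \<alpha> a b) - inverse (log_mean a b)\<bar>
         in
         (\<alpha> * \<mu> \<le> 1 - \<alpha> \<and> 1 - \<alpha> \<le> 1 - \<mu> * (1 - \<alpha>) \<longrightarrow>
            D \<le> (b - a) * (gamma2 \<alpha> \<mu> + upsilon2 \<alpha> \<mu>) * K_sup q a b powr (1 / q)) \<and>
         (\<alpha> * \<mu> \<le> 1 - \<mu> * (1 - \<alpha>) \<and> 1 - \<mu> * (1 - \<alpha>) \<le> 1 - \<alpha> \<longrightarrow>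
            D \<le> (b - a) * (gamma2 \<alpha> \<mu> + upsilon1 \<alpha> \<mu>) * K_sup q a b powr (1 / q)) \<and>
         (1 - \<alpha> \<le> \<alpha> * \<mu> \<and> \<alpha> * \<mu> \<le> 1 - \<mu> * (1 - \<alpha>) \<longrightarrow>
            D \<le> (b - a) * (gamma1 \<alpha> \<mu> + upsilon2 \<alpha> \<mu>) * K_sup q a b powr (1 / q))"
proof -
  have \<alpha>: "0 \<le> \<alpha>" "\<alpha> \<le> 1" and \<mu>: "0 \<le> \<mu>" "\<mu> \<le> 1" using assms by auto
  have K: "K_sup q a b powr (1 / q) = 1 / a\<^sup>2"
    using assms by (intro K_sup_powr) auto
  \<comment> \<open>\<open>P\<close> and \<open>Q\<close> are the integrals of the absolute kernels
    over \<open>{0..1 - \<alpha>}\<close> and \<open>{1 - \<alpha>..1}\<close>.\<close>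
  define P where "P = (1 - \<alpha> - \<alpha> * \<mu>) * \<bar>1 - \<alpha> - \<alpha> * \<mu>\<bar> / 2 + \<alpha> * \<mu> * \<bar>\<alpha> * \<mu>\<bar> / 2"
  define Q where "Q = \<mu> * (1 - \<alpha>) * \<bar>\<mu> * (1 - \<alpha>)\<bar> / 2
            - (\<mu> * (1 - \<alpha>) - \<alpha>) * \<bar>\<mu> * (1 - \<alpha>) - \<alpha>\<bar> / 2"
  have abs1: "\<bar>\<alpha> * \<mu>\<bar> = \<alpha> * \<mu>" and abs2: "\<bar>\<mu> * (1 - \<alpha>)\<bar> = \<mu> * (1 - \<alpha>)"
    using \<alpha> \<mu> by simp_all
  \<comment> \<open>The kernel zero \<open>\<alpha> * \<mu>\<close> lies inside the first piece
    here, and at or beyond its right end in \<open>P1\<close>.\<close>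
  have P2: "P = gamma2 \<alpha> \<mu>" if "\<alpha> * \<mu> \<le> 1 - \<alpha>"
  proof -
    from that have "\<bar>1 - \<alpha> - \<alpha> * \<mu>\<bar> = 1 - \<alpha> - \<alpha> * \<mu>" by simp
    then show ?thesis
      unfolding P_def gamma2_def gamma1_def abs1 by (simp add: field_simps power2_eq_square)
  qed
  have P1: "P = gamma1 \<alpha> \<mu>" if "1 - \<alpha> \<le> \<alpha> * \<mu>"
  proof -
    from that have "\<bar>1 - \<alpha> - \<alpha> * \<mu>\<bar> = - (1 - \<alpha> - \<alpha> * \<mu>)" by simp
    then show ?thesis
      unfolding P_def gamma1_def abs1 by (simp add: field_simps power2_eq_square)
  qed
  \<comment> \<open>Likewise the zero \<open>1 - \<mu> * (1 - \<alpha>)\<close> lies inside the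
    second piece here, and at or before its left end in \<open>Q1\<close>.\<close>
  have Q2: "Q = upsilon2 \<alpha> \<mu>" if "1 - \<alpha> \<le> 1 - \<mu> * (1 - \<alpha>)"
  proof -
    from that have "\<bar>\<mu> * (1 - \<alpha>) - \<alpha>\<bar> = - (\<mu> * (1 - \<alpha>) - \<alpha>)" by simp
    then show ?thesis
      unfolding Q_def upsilon2_def abs2 by (simp add: field_simps power2_eq_square)
  qed
  have Q1: "Q = upsilon1 \<alpha> \<mu>" if "1 - \<mu> * (1 - \<alpha>) \<le> 1 - \<alpha>"
  proof -
    from that have "\<bar>\<mu> * (1 - \<alpha>) - \<alpha>\<bar> = \<mu> * (1 - \<alpha>) - \<alpha>" by simp
    then show ?thesis
      unfolding Q_def upsilon1_def abs2 by (simp add: field_simps power2_eq_square)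
  qed
  have "\<bar>\<mu> * inverse (harm_mean \<alpha> a b) + (1 - \<mu>) * inverse (arith_mean \<alpha> a b)
            - inverse (log_mean a b)\<bar> \<le> (b - a) * (P + Q) * (1 / a\<^sup>2)"
    using weighted_means_deviation_bound[of a b \<alpha> \<mu>] assms by (simp add: P_def Q_def)
  then show ?thesis
    unfolding Let_def K using P1 P2 Q1 Q2 by auto
qed

end
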